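(* Let $\{D_{n,i},\mathcal{F}_{n,i},\ 1\leq i\leq n\}$, $n\geq 1$, be a martingale-difference array and $\{c_n,\ n\geq 1\}$ a non-increasing sequence of positive numbers. Assume that $\mathcal{F}_{n,i}=\mathcal{F}_i$ for all $i,n$ (the sigma-algebras do not depend on $n$). Suppose that there exists $p\geq 1$ such that for any $n_0\geq 1$ $$\lim_{n\to\infty}\left(c_n^p\,\mathbb{E}\left[|S_{n_0,n}|^p\right]+\sum_{k=n}^\infty\left(c_k^p-c_{k+1}^p\right)\mathbb{E}\left[|S_{n,k}|^p\right]\right)=0\quad\text{and}\quad \sum_{n\geq 1}c_n\left(\mathbb{E}\left[|R_n|^p\right]\right)^{1/p}<\infty.$$ Then $c_nM_{n,n}$ converges almost surely to zero as $n\to\infty$.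
   Context: $(\Omega,\mathcal{F},\mathbb{P})$ is a probability space with expectation $\mathbb{E}$. A martingale-difference array $\{D_{n,i},\mathcal{F}_{n,i},\ 1\leq i\leq n\}$, $n\geq 1$, consists, for each $n\ge 1$, of a non-decreasing sequence $\{\mathcal{F}_{n,i},\ 1\le i\le n\}$ of sub-sigma-algebras of $\mathcal{F}$ and real random variables $D_{n,i}$, $1\le i\le n$, with $D_{n,i}$ being $\mathcal{F}_{n,i}$-measurable, $\mathbb{E}(|D_{n,i}|)<\infty$ and $\mathbb{E}(D_{n,i}\mid\mathcal{F}_{n,i-1})=0$ for all $1\le i\le n$, where $\mathcal{F}_{n,0}=\{\emptyset,\Omega\}$. Notation: $M_{n,k}:=\sum_{i=1}^k D_{n,i}$ for $1\le k\le n$, $n\ge 1$. For $n\ge1$, $$S_{n,k}:=M_{n,k}=\sum_{i=1}^k D_{n,i}\ \text{ if } 1\le k\le n,\qquad S_{n,k}:=\sum_{i=1}^n D_{n,i}+\sum_{j=n+1}^k D_{j,j}\ \text{ if } k>n.$$ Finally $R_n:=\sum_{j=1}^{n-1}\left(D_{n,j}-D_{n-1,j}\right)$ (an empty sum is $0$). *)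

theory Defs
  imports "HOL-Probability.Probability"
begin

(* The index 0 of each row carries the trivial sigma-algebra; values of F and D outside
   0 <= i <= n (resp. 1 <= i <= n), and the row n = 0, are unconstrained. *)
definition martingale_difference_array ::
  "'a measure \<Rightarrow> (nat \<Rightarrow> nat \<Rightarrow> 'a measure) \<Rightarrow> (nat \<Rightarrow> nat \<Rightarrow> 'a \<Rightarrow> real) \<Rightarrow> bool" where
  "martingale_difference_array P F D \<longleftrightarrow>
    (\<forall>n\<ge>1.
      (\<forall>i\<le>n. subalgebra P (F n i)) \<and>
      sets (F n 0) = {{}, space P} \<and>
      (\<forall>i j. 1 \<le> i \<and> i \<le> j \<and> j \<le> n \<longrightarrow> sets (F n i) \<subseteq> sets (F n j)) \<and>
      (\<forall>i. 1 \<le> i \<and> i \<le> n \<longrightarrow>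
        D n i \<in> borel_measurable (F n i) \<and>
        integrable P (D n i) \<and>
        (AE \<omega> in P. real_cond_exp P (F n (i - 1)) (D n i) \<omega> = 0)))"

definition row_sum :: "(nat \<Rightarrow> nat \<Rightarrow> 'a \<Rightarrow> real) \<Rightarrow> nat \<Rightarrow> nat \<Rightarrow> 'a \<Rightarrow> real" where
  "row_sum D n k \<omega> = (\<Sum>i=1..k. D n i \<omega>)"

definition extended_sum :: "(nat \<Rightarrow> nat \<Rightarrow> 'a \<Rightarrow> real) \<Rightarrow> nat \<Rightarrow> nat \<Rightarrow> 'a \<Rightarrow> real" where
  "extended_sum D n k \<omega> =
    (if k \<le> n then row_sum D n k \<omega>
     else (\<Sum>i=1..n. D n i \<omega>) + (\<Sum>j=n+1..k. D j j \<omega>))"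

definition row_change :: "(nat \<Rightarrow> nat \<Rightarrow> 'a \<Rightarrow> real) \<Rightarrow> nat \<Rightarrow> 'a \<Rightarrow> real" where
  "row_change D n \<omega> = (\<Sum>j=1..<n. D n j \<omega> - D (n - 1) j \<omega>)"

(* E[|X|^p], possibly infinite: the Bochner integral would return 0 when |X|^p is not
   integrable, making moment conditions vacuous. *)
definition abs_moment :: "'a measure \<Rightarrow> real \<Rightarrow> ('a \<Rightarrow> real) \<Rightarrow> ennreal" where
  "abs_moment P p X = (\<integral>\<^sup>+ \<omega>. ennreal (\<bar>X \<omega>\<bar> powr p) \<partial>P)"

(* (E[|X|^p])^(1/p), infinite when the moment is; powr is not available on ennreal. *)
definition Lp_norm :: "'a measure \<Rightarrow> real \<Rightarrow> ('a \<Rightarrow> real) \<Rightarrow> ennreal" where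
  "Lp_norm P p X =
    (if abs_moment P p X = \<infinity> then \<infinity>
     else ennreal (enn2real (abs_moment P p X) powr (1 / p)))"

end

theory Submission
  imports Defs
begin

text \<open>Since \<open>M(k,k) - M(k-1,k-1) = D(k,k) + R(k)\<close>, we have
  \<open>M(k,k) = S(n,k) + (R(n+1) + \<dots> + R(k))\<close> for \<open>k \<ge> n\<close>. For fixed \<open>n\<close> the sequence \<open>S(n,k)\<close>,
  \<open>k \<ge> n\<close>, is a martingale, so a weighted maximal inequality for \<open>|S(n,k)|\<^sup>p\<close> bounds the probability
  that \<open>c(k) |S(n,k)|\<close> reaches a given level for some \<open>k \<ge> n\<close> by a quantity that vanishes as
  \<open>n \<rightarrow> \<infinity>\<close>; hence almost surely there are infinitely many \<open>n\<close> for which it is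
  never reached.
  As \<open>c\<close> is non-increasing, the remaining part is at most the tail of \<open>\<Sum> c(j) |R(j)|\<close>, which
  converges almost surely because its expectation is finite.\<close>

section \<open>Moment inequalities for p-th powers\<close>

lemma convex_on_abs_powr:
  assumes "1 \<le> (p::real)"
  shows "convex_on UNIV (\<lambda>x::real. \<bar>x\<bar> powr p)"
proof (rule convex_onI)
  fix t x y :: real
  assume t: "0 < t" "t < 1"
  \<comment> \<open>Needed when an endpoint is zero: the convex combination then reduces to one
    scaled term, and \<open>s powr p \<le> s\<close> for \<open>s\<close> in [0,1] because
    \<open>p \<ge> 1\<close>. Two nonzero endpoints are handled by \<open>powr_convex\<close>
    applied to their absolute values.\<close>
  have scale: "(s * a) powr p \<le> s * a powr p" if "0 \<le> s" "s \<le> 1" "0 \<le> a" for s a :: real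
  proof -
    have "s powr p \<le> s"
      using powr_mono'[of 1 p s] that assms by simp
    then show ?thesis
      using that by (simp add: powr_mult mult_right_mono)
  qed
  have "\<bar>(1 - t) * x + t * y\<bar> \<le> (1 - t) * \<bar>x\<bar> + t * \<bar>y\<bar>"
    using t abs_triangle_ineq[of "(1 - t) * x" "t * y"] by (simp add: abs_mult)
  then have "\<bar>(1 - t) * x + t * y\<bar> powr p \<le> ((1 - t) * \<bar>x\<bar> + t * \<bar>y\<bar>) powr p"
    using assms by (intro powr_mono2) auto
  also have "\<dots> \<le> (1 - t) * \<bar>x\<bar> powr p + t * \<bar>y\<bar> powr p"
  proof (cases "x = 0 \<or> y = 0")
    case True
    then show ?thesis
      using scale[of "1 - t" "\<bar>x\<bar>"] scale[of t "\<bar>y\<bar>"] t assms by auto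
  next
    case False
    then show ?thesis
      using convex_onD[OF powr_convex[OF assms], of t "\<bar>x\<bar>" "\<bar>y\<bar>"] t by simp
  qed
  finally show "\<bar>(1 - t) *\<^sub>R x + t *\<^sub>R y\<bar> powr p \<le> (1 - t) * \<bar>x\<bar> powr p + t * \<bar>y\<bar> powr p"
    by simp
qed simp

text \<open>Jensen's inequality for the convex p-th power, followed by taking p-th roots. It turns
  the summability assumption on the p-norms of \<open>row_change\<close> into finiteness of a
  weighted sum of first absolute moments.\<close>

lemma (in prob_space) nn_integral_abs_le_Lp_norm:
  assumes "1 \<le> p" and X: "integrable M X"
  shows "(\<integral>\<^sup>+\<omega>. ennreal \<bar>X \<omega>\<bar> \<partial>M) \<le> Lp_norm M p X"
proof (cases "abs_moment M p X = \<infinity>")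
  case True
  then show ?thesis by (simp add: Lp_norm_def)
next
  case False
  have [measurable]: "X \<in> borel_measurable M" using X by simp
  have int: "integrable M (\<lambda>\<omega>. \<bar>X \<omega>\<bar> powr p)"
    using False by (intro integrableI_nonneg) (auto simp: abs_moment_def less_top)
  have eq: "abs_moment M p X = ennreal (\<integral>\<omega>. \<bar>X \<omega>\<bar> powr p \<partial>M)"
    unfolding abs_moment_def using int by (intro nn_integral_eq_integral) auto
  have "\<bar>\<integral>\<omega>. \<bar>X \<omega>\<bar> \<partial>M\<bar> powr p \<le> (\<integral>\<omega>. \<bar>\<bar>X \<omega>\<bar>\<bar> powr p \<partial>M)"
    using X int convex_on_abs_powr[OF \<open>1 \<le> p\<close>]
    by (intro jensens_inequality[where I = UNIV]) auto
  then have "(\<bar>\<integral>\<omega>. \<bar>X \<omega>\<bar> \<partial>M\<bar> powr p) powr (1 / p) \<le> (\<integral>\<omega>. \<bar>X \<omega>\<bar> powr p \<partial>M) powr (1 / p)"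
    using \<open>1 \<le> p\<close> by (intro powr_mono2) auto
  then have "(\<integral>\<omega>. \<bar>X \<omega>\<bar> \<partial>M) \<le> (\<integral>\<omega>. \<bar>X \<omega>\<bar> powr p \<partial>M) powr (1 / p)"
    using \<open>1 \<le> p\<close> by (simp add: powr_powr)
  moreover have "(\<integral>\<^sup>+\<omega>. ennreal \<bar>X \<omega>\<bar> \<partial>M) = ennreal (\<integral>\<omega>. \<bar>X \<omega>\<bar> \<partial>M)"
    using X by (intro nn_integral_eq_integral) auto
  ultimately show ?thesis
    by (simp add: Lp_norm_def eq ennreal_leI)
qed

text \<open>The moments may be infinite, so Jensen's inequality is applied to \<open>\<one>\<^sub>A (X + Y)\<close>, and only when
  \<open>\<one>\<^sub>A |X + Y|\<^sup>p\<close> is integrable.\<close>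

lemma (in prob_space) nn_integral_abs_powr_martingale_step:
  assumes sub: "subalgebra M H" and "1 \<le> p"
    and X: "X \<in> borel_measurable H" "integrable M X"
    and Y: "integrable M Y" "AE \<omega> in M. real_cond_exp M H Y \<omega> = 0"
    and A: "A \<in> sets H"
  shows "(\<integral>\<^sup>+\<omega>. ennreal (\<bar>X \<omega>\<bar> powr p) * indicator A \<omega> \<partial>M)
    \<le> (\<integral>\<^sup>+\<omega>. ennreal (\<bar>X \<omega> + Y \<omega>\<bar> powr p) * indicator A \<omega> \<partial>M)"
proof -
  interpret finite_measure_subalgebra M H
    using sub by unfold_locales
  have [measurable]: "A \<in> sets M" "X \<in> borel_measurable M" "Y \<in> borel_measurable M"
    using A sub X Y by (auto simp: subalgebra_def)
  define Z where "Z \<omega> = indicator A \<omega> * (X \<omega> + Y \<omega>)" for \<omega>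
  have Z: "integrable M Z"
    unfolding Z_def using X Y
    by (intro integrable_real_mult_indicator[of A M "\<lambda>\<omega>. X \<omega> + Y \<omega>", simplified mult.commute]) auto
  have Z_eq: "ennreal (\<bar>Z \<omega>\<bar> powr p) = ennreal (\<bar>X \<omega> + Y \<omega>\<bar> powr p) * indicator A \<omega>" for \<omega>
    by (simp add: Z_def indicator_def)
  show ?thesis
  proof (cases "(\<integral>\<^sup>+\<omega>. ennreal (\<bar>Z \<omega>\<bar> powr p) \<partial>M) = \<infinity>")
    case True
    then show ?thesis by (simp add: Z_eq)
  next
    case False
    have int: "integrable M (\<lambda>\<omega>. \<bar>Z \<omega>\<bar> powr p)"
      using False Z by (intro integrableI_nonneg) (auto simp: less_top)
    \<comment> \<open>Both \<open>A\<close> and \<open>X\<close> are known to \<open>H\<close>, so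
      the indicator factors out, \<open>X\<close> is its own conditional expectation, and
      \<open>Y\<close> contributes zero.\<close>
    have "AE \<omega> in M. real_cond_exp M H Z \<omega> = indicator A \<omega> * real_cond_exp M H (\<lambda>\<omega>. X \<omega> + Y \<omega>) \<omega>"
      unfolding Z_def using A Z by (intro real_cond_exp_mult) (auto simp: Z_def[abs_def])
    moreover have "AE \<omega> in M. real_cond_exp M H (\<lambda>\<omega>. X \<omega> + Y \<omega>) \<omega> = real_cond_exp M H X \<omega> + real_cond_exp M H Y \<omega>"
      using X Y by (intro real_cond_exp_add) auto
    moreover have "AE \<omega> in M. real_cond_exp M H X \<omega> = X \<omega>"
      using X by (intro real_cond_exp_F_meas) auto
    ultimately have "AE \<omega> in M. real_cond_exp M H Z \<omega> = indicator A \<omega> * X \<omega>"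
      using Y(2) by eventually_elim simp
    moreover have "AE \<omega> in M. \<bar>real_cond_exp M H Z \<omega>\<bar> powr p \<le> real_cond_exp M H (\<lambda>\<omega>. \<bar>Z \<omega>\<bar> powr p) \<omega>"
      using Z int convex_on_abs_powr[OF \<open>1 \<le> p\<close>]
      by (intro real_cond_exp_jensens_inequality(2)[where I = UNIV]) auto
    ultimately have le: "AE \<omega> in M. \<bar>indicator A \<omega> * X \<omega>\<bar> powr p \<le> real_cond_exp M H (\<lambda>\<omega>. \<bar>Z \<omega>\<bar> powr p) \<omega>"
      by eventually_elim simp
    \<comment> \<open>Nonnegativity is inherited from the Jensen lower bound; it is what allows the
      conditional expectation to pass between the two kinds of integral.\<close>
    then have nonneg: "AE \<omega> in M. 0 \<le> real_cond_exp M H (\<lambda>\<omega>. \<bar>Z \<omega>\<bar> powr p) \<omega>"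
      by eventually_elim (rule order_trans[OF powr_ge_zero])
    have "(\<integral>\<^sup>+\<omega>. ennreal (\<bar>X \<omega>\<bar> powr p) * indicator A \<omega> \<partial>M)
        \<le> (\<integral>\<^sup>+\<omega>. ennreal (real_cond_exp M H (\<lambda>\<omega>. \<bar>Z \<omega>\<bar> powr p) \<omega>) \<partial>M)"
      using le by (intro nn_integral_mono_AE, eventually_elim) (auto simp: indicator_def ennreal_leI)
    also have "\<dots> = ennreal (\<integral>\<omega>. real_cond_exp M H (\<lambda>\<omega>. \<bar>Z \<omega>\<bar> powr p) \<omega> \<partial>M)"
      using int nonneg by (intro nn_integral_eq_integral) auto
    also have "\<dots> = ennreal (\<integral>\<omega>. \<bar>Z \<omega>\<bar> powr p \<partial>M)"
      by (simp add: real_cond_exp_int(2)[OF int])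
    also have "\<dots> = (\<integral>\<^sup>+\<omega>. ennreal (\<bar>Z \<omega>\<bar> powr p) \<partial>M)"
      using int by (intro nn_integral_eq_integral[symmetric]) auto
    finally show ?thesis by (simp add: Z_eq)
  qed
qed

section \<open>Maximal inequalities for nonnegative submartingales\<close>

text \<open>The Hajek--Renyi--Chow maximal inequality. Abel summation is carried along the induction on
  \<open>N\<close>, where the submartingale property is used only on the event that the level has already been
  reached; this avoids subtracting possibly infinite expectations.\<close>

lemma submartingale_maximal_inequality:
  fixes X :: "nat \<Rightarrow> 'a \<Rightarrow> ennreal" and u :: "nat \<Rightarrow> ennreal"
  assumes sub: "\<And>k. subalgebra M (H k)" and mono: "\<And>k. sets (H k) \<subseteq> sets (H (Suc k))"
    and X: "\<And>k. X k \<in> borel_measurable (H k)"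
    and submart: "\<And>k A. A \<in> sets (H k) \<Longrightarrow>
      (\<integral>\<^sup>+\<omega>. X k \<omega> * indicator A \<omega> \<partial>M) \<le> (\<integral>\<^sup>+\<omega>. X (Suc k) \<omega> * indicator A \<omega> \<partial>M)"
    and u: "\<And>k. u (Suc k) \<le> u k" "\<And>k. u k < \<top>"
  shows "e * emeasure M {\<omega> \<in> space M. \<exists>k\<le>N. e \<le> u k * X k \<omega>}
    \<le> u N * (\<integral>\<^sup>+\<omega>. X N \<omega> \<partial>M) + (\<Sum>k<N. (u k - u (Suc k)) * (\<integral>\<^sup>+\<omega>. X k \<omega> \<partial>M))"
proof -
  define E where "E N = {\<omega> \<in> space M. \<exists>k\<le>N. e \<le> u k * X k \<omega>}" for N
  have space_H: "space (H k) = space M" for k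
    using sub by (simp add: subalgebra_def)
  have lvl: "{\<omega> \<in> space M. e \<le> u k * X k \<omega>} \<in> sets (H k)" for k
  proof -
    note [measurable] = X[of k]
    have "{\<omega> \<in> space (H k). e \<le> u k * X k \<omega>} \<in> sets (H k)" by measurable
    then show ?thesis by (simp add: space_H)
  qed
  have E_Suc: "E (Suc n) = E n \<union> {\<omega> \<in> space M. e \<le> u (Suc n) * X (Suc n) \<omega>}" for n
    by (auto simp: E_def le_Suc_eq)
  have E_H: "E n \<in> sets (H n)" for n
  proof (induction n)
    case 0
    then show ?case using lvl[of 0] by (simp add: E_def)
  next
    case (Suc n)
    then show ?case unfolding E_Suc using mono lvl by blast
  qed
  have HM: "A \<in> sets M" if "A \<in> sets (H k)" for A k
    using that sub by (auto simp: subalgebra_def)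
  have [measurable]: "E n \<in> sets M" "{\<omega> \<in> space M. e \<le> u n * X n \<omega>} \<in> sets M" for n
    using E_H lvl HM by blast+
  have [measurable]: "X k \<in> borel_measurable M" for k
    using X sub measurable_from_subalg by blast
  define I where "I k A = (\<integral>\<^sup>+\<omega>. X k \<omega> * indicator A \<omega> \<partial>M)" for k A
  \<comment> \<open>Markov's inequality restricted to a set on which the weighted process is at
    least \<open>e\<close>.\<close>
  have level: "e * emeasure M A \<le> u k * I k A"
    if [measurable]: "A \<in> sets M" and A: "\<And>\<omega>. \<omega> \<in> A \<Longrightarrow> e \<le> u k * X k \<omega>" for A k
  proof -
    have "e * emeasure M A = (\<integral>\<^sup>+\<omega>. e * indicator A \<omega> \<partial>M)"
      by (simp add: nn_integral_cmult)
    also have "\<dots> \<le> (\<integral>\<^sup>+\<omega>. u k * (X k \<omega> * indicator A \<omega>) \<partial>M)"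
      using A by (intro nn_integral_mono) (auto simp: indicator_def)
    also have "\<dots> = u k * I k A"
      unfolding I_def by (rule nn_integral_cmult) measurable
    finally show ?thesis .
  qed
  \<comment> \<open>The induction proves a sharper bound, in which each integral is taken only over
    \<open>E k\<close>; the restriction is dropped after the induction.\<close>
  have "e * emeasure M (E N) \<le> u N * I N (E N) + (\<Sum>k<N. (u k - u (Suc k)) * I k (E k))"
  proof (induction N)
    case 0
    have "e * emeasure M (E 0) \<le> u 0 * I 0 (E 0)"
      by (rule level) (auto simp: E_def)
    then show ?case by simp
  next
    case (Suc N)
    \<comment> \<open>\<open>B\<close> is the event that the level is reached for the first time at
      \<open>Suc N\<close>.\<close>
    define B where "B = E (Suc N) - E N"
    have [measurable]: "B \<in> sets M" by (simp add: B_def)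
    have un: "E (Suc N) = E N \<union> B" "E N \<inter> B = {}"
      by (auto simp: B_def E_Suc)
    have I_un: "I (Suc N) (E (Suc N)) = I (Suc N) (E N) + I (Suc N) B"
    proof -
      have "I (Suc N) (E (Suc N))
          = (\<integral>\<^sup>+\<omega>. X (Suc N) \<omega> * indicator (E N) \<omega> + X (Suc N) \<omega> * indicator B \<omega> \<partial>M)"
        unfolding I_def un(1) using un(2) by (intro nn_integral_cong) (auto simp: indicator_def)
      also have "\<dots> = I (Suc N) (E N) + I (Suc N) B"
        unfolding I_def by (rule nn_integral_add) measurable
      finally show ?thesis .
    qed
    \<comment> \<open>One step of Abel summation: split \<open>u N\<close> into
      \<open>u (Suc N)\<close> and the decrement. The decrement gives the new term of the sum; the
      other piece moves to time \<open>Suc N\<close> by the submartingale property, applicable since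
      \<open>E N\<close> belongs to \<open>H N\<close>.\<close>
    have "u N * I N (E N) = u (Suc N) * I N (E N) + (u N - u (Suc N)) * I N (E N)"
      using u[of N] by (simp add: distrib_right[symmetric] add_diff_inverse_ennreal)
    also have "\<dots> \<le> u (Suc N) * I (Suc N) (E N) + (u N - u (Suc N)) * I N (E N)"
      unfolding I_def using submart[OF E_H] by (intro add_mono mult_left_mono) auto
    finally have step: "u N * I N (E N)
      \<le> u (Suc N) * I (Suc N) (E N) + (u N - u (Suc N)) * I N (E N)" .
    have B_level: "e * emeasure M B \<le> u (Suc N) * I (Suc N) B"
      by (rule level) (auto simp: B_def E_Suc)
    have "e * emeasure M (E (Suc N)) = e * emeasure M (E N) + e * emeasure M B"
      using un by (simp add: plus_emeasure[symmetric] distrib_left)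
    also have "\<dots> \<le> (u (Suc N) * I (Suc N) (E N) + (u N - u (Suc N)) * I N (E N)
        + (\<Sum>k<N. (u k - u (Suc k)) * I k (E k))) + u (Suc N) * I (Suc N) B"
      by (intro add_mono B_level order_trans[OF Suc] step order_refl)
    also have "\<dots> = u (Suc N) * I (Suc N) (E (Suc N)) + (\<Sum>k<Suc N. (u k - u (Suc k)) * I k (E k))"
      by (simp add: I_un distrib_left ac_simps)
    finally show ?case .
  qed
  also have "\<dots> \<le> u N * (\<integral>\<^sup>+\<omega>. X N \<omega> \<partial>M) + (\<Sum>k<N. (u k - u (Suc k)) * (\<integral>\<^sup>+\<omega>. X k \<omega> \<partial>M))"
    unfolding I_def
    by (intro add_mono sum_mono mult_left_mono nn_integral_mono) (auto simp: indicator_def)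
  finally show ?thesis by (simp add: E_def)
qed

text \<open>Let \<open>N\<close> tend to infinity in the finite bound: the events increase to their
  union, the boundary term vanishes by \<open>lim\<close>, and the partial sums stay below the
  series. Finiteness of \<open>e\<close> makes multiplication by \<open>e\<close>
  continuous.\<close>

lemma submartingale_maximal_inequality_infinite:
  fixes X :: "nat \<Rightarrow> 'a \<Rightarrow> ennreal" and u :: "nat \<Rightarrow> ennreal"
  assumes sub: "\<And>k. subalgebra M (H k)" and mono: "\<And>k. sets (H k) \<subseteq> sets (H (Suc k))"
    and X: "\<And>k. X k \<in> borel_measurable (H k)"
    and submart: "\<And>k A. A \<in> sets (H k) \<Longrightarrow>
      (\<integral>\<^sup>+\<omega>. X k \<omega> * indicator A \<omega> \<partial>M) \<le> (\<integral>\<^sup>+\<omega>. X (Suc k) \<omega> * indicator A \<omega> \<partial>M)"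
    and u: "\<And>k. u (Suc k) \<le> u k" "\<And>k. u k < \<top>"
    and lim: "(\<lambda>N. u N * (\<integral>\<^sup>+\<omega>. X N \<omega> \<partial>M)) \<longlonglongrightarrow> 0"
    and "e < \<top>"
  shows "e * emeasure M {\<omega> \<in> space M. \<exists>k. e \<le> u k * X k \<omega>}
    \<le> (\<Sum>k. (u k - u (Suc k)) * (\<integral>\<^sup>+\<omega>. X k \<omega> \<partial>M))"
proof -
  define E where "E N = {\<omega> \<in> space M. \<exists>k\<le>N. e \<le> u k * X k \<omega>}" for N
  let ?S = "\<Sum>k. (u k - u (Suc k)) * (\<integral>\<^sup>+\<omega>. X k \<omega> \<partial>M)"
  have [measurable]: "X k \<in> borel_measurable M" for k
    using X sub measurable_from_subalg by blast
  have "range E \<subseteq> sets M"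
    unfolding E_def by auto
  moreover have "incseq E"
    by (intro monoI) (auto simp: E_def intro: order_trans)
  ultimately have "(\<lambda>N. emeasure M (E N)) \<longlonglongrightarrow> emeasure M (\<Union>N. E N)"
    by (rule Lim_emeasure_incseq)
  also have "(\<Union>N. E N) = {\<omega> \<in> space M. \<exists>k. e \<le> u k * X k \<omega>}"
    by (auto simp: E_def)
  finally have "(\<lambda>N. e * emeasure M (E N)) \<longlonglongrightarrow>
      e * emeasure M {\<omega> \<in> space M. \<exists>k. e \<le> u k * X k \<omega>}"
    using \<open>e < \<top>\<close> by (intro ennreal_tendsto_cmult)
  moreover have "(\<lambda>N. u N * (\<integral>\<^sup>+\<omega>. X N \<omega> \<partial>M) + ?S) \<longlonglongrightarrow> 0 + ?S"
    using lim by (intro tendsto_add tendsto_const)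
  moreover have "e * emeasure M (E N) \<le> u N * (\<integral>\<^sup>+\<omega>. X N \<omega> \<partial>M) + ?S" for N
    unfolding E_def
    by (rule order_trans[OF submartingale_maximal_inequality[where H = H]])
       (auto intro!: add_left_mono sum_le_suminf sub X submart u mono[THEN subsetD])
  ultimately show ?thesis
    using LIMSEQ_le by fastforce
qed

section \<open>Pathwise decomposition of the diagonal sums\<close>

lemma row_sum_diagonal_decomposition:
  assumes "1 \<le> n" "n \<le> k"
  shows "row_sum D k k \<omega> = extended_sum D n k \<omega> + (\<Sum>j=n+1..k. row_change D j \<omega>)"
  using \<open>n \<le> k\<close>
proof (induction k rule: dec_induct)
  case base
  then show ?case by (simp add: extended_sum_def)
next
  case (step k)
  \<comment> \<open>\<open>row_change D (Suc k)\<close> is the effect of replacing row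
    \<open>k\<close> by row \<open>Suc k\<close> in the first \<open>k\<close> summands.\<close>
  have "row_sum D (Suc k) (Suc k) \<omega> = row_sum D k k \<omega> + D (Suc k) (Suc k) \<omega> + row_change D (Suc k) \<omega>"
    by (simp add: row_sum_def row_change_def sum_subtractf atLeastLessThanSuc_atLeastAtMost)
  moreover have "extended_sum D n (Suc k) \<omega> = extended_sum D n k \<omega> + D (Suc k) (Suc k) \<omega>"
    \<comment> \<open>At \<open>k = n\<close> the definition of \<open>extended_sum\<close> switches
      from its first branch to its second.\<close>
    using step by (cases "k = n") (auto simp: extended_sum_def row_sum_def)
  ultimately show ?case
    using step by simp
qed

text \<open>As \<open>c k \<le> c j\<close> for \<open>j \<le> k\<close>, the outer weight can be
  replaced by the weight of each summand. The resulting tail does not depend on \<open>k\<close>, so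
  it controls all later times at once.\<close>

lemma weighted_sum_bound:
  fixes c r :: "nat \<Rightarrow> real"
  assumes "\<And>n. 1 \<le> n \<Longrightarrow> 0 < c n" "\<And>m n. 1 \<le> m \<Longrightarrow> m \<le> n \<Longrightarrow> c n \<le> c m"
    and summ: "summable (\<lambda>j. c (j + 1) * \<bar>r (j + 1)\<bar>)"
  shows "c k * \<bar>\<Sum>j=n+1..k. r j\<bar> \<le> (\<Sum>j. c (j + n + 1) * \<bar>r (j + n + 1)\<bar>)"
proof (cases "n < k")
  case True
  have "c k * \<bar>\<Sum>j=n+1..k. r j\<bar> \<le> c k * (\<Sum>j=n+1..k. \<bar>r j\<bar>)"
    using assms(1)[of k] True by (intro mult_left_mono) auto
  also have "\<dots> \<le> (\<Sum>j=n+1..k. c j * \<bar>r j\<bar>)"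
    unfolding sum_distrib_left using assms(2) by (intro sum_mono mult_right_mono) auto
  also have "\<dots> = (\<Sum>j<k-n. c (j + n + 1) * \<bar>r (j + n + 1)\<bar>)"
    using True by (intro sum.reindex_bij_witness[of _ "\<lambda>j. j + n + 1" "\<lambda>j. j - (n + 1)"]) auto
  also have "\<dots> \<le> (\<Sum>j. c (j + n + 1) * \<bar>r (j + n + 1)\<bar>)"
    using summable_ignore_initial_segment[OF summ, of n] less_imp_le[OF assms(1)]
    by (intro sum_le_suminf) (auto intro!: mult_nonneg_nonneg)
  finally show ?thesis .
next
  case False
  then show ?thesis
    using summable_ignore_initial_segment[OF summ, of n] less_imp_le[OF assms(1)]
    by (auto intro!: suminf_nonneg mult_nonneg_nonneg)
qed

section \<open>Martingale-difference arrays over a common filtration\<close>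

context
  fixes P :: "'a measure" and F :: "nat \<Rightarrow> nat \<Rightarrow> 'a measure" and G :: "nat \<Rightarrow> 'a measure"
    and D :: "nat \<Rightarrow> nat \<Rightarrow> 'a \<Rightarrow> real"
  assumes prob: "prob_space P"
    and mda: "martingale_difference_array P F D"
    and F_G: "\<And>n i. 1 \<le> i \<Longrightarrow> i \<le> n \<Longrightarrow> sets (F n i) = sets (G i)"
begin

lemma array_subalgebra: "1 \<le> n \<Longrightarrow> i \<le> n \<Longrightarrow> subalgebra P (F n i)"
  using mda by (simp add: martingale_difference_array_def)

lemma array_integrable: "1 \<le> i \<Longrightarrow> i \<le> n \<Longrightarrow> integrable P (D n i)"
  using mda by (simp add: martingale_difference_array_def)

lemma array_sets_mono: "1 \<le> i \<Longrightarrow> i \<le> j \<Longrightarrow> sets (G i) \<subseteq> sets (G j)"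
  using mda F_G[of i j] F_G[of j j] unfolding martingale_difference_array_def
  by (metis le_trans order_refl)

text \<open>\<open>extended_sum\<close> mixes row \<open>n\<close> with diagonal entries of later
  rows. Since the sigma-algebras agree across rows and increase with the index, all these entries
  are adapted to one filtration.\<close>

lemma array_measurable:
  assumes "1 \<le> i" "i \<le> n" "i \<le> k" "k \<le> m"
  shows "D n i \<in> borel_measurable (F m k)"
proof -
  have "D n i \<in> borel_measurable (F n i)"
    using mda assms by (simp add: martingale_difference_array_def)
  moreover have "sets (F n i) \<subseteq> sets (F m k)"
    using F_G[of i n] F_G[of k m] array_sets_mono[of i k] assms by auto
  moreover have "space (F n i) = space (F m k)"
    using array_subalgebra[of n i] array_subalgebra[of m k] assms by (simp add: subalgebra_def)
  ultimately show ?thesis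
    unfolding measurable_def by auto
qed

lemma integrable_row_change: "integrable P (row_change D (n + 1))"
  unfolding row_change_def[abs_def]
  by (intro Bochner_Integration.integrable_sum Bochner_Integration.integrable_diff array_integrable) auto

lemma extended_sum_measurable:
  assumes "1 \<le> n" "n \<le> k" "k \<le> m"
  shows "extended_sum D n k \<in> borel_measurable (F m k)"
proof -
  \<comment> \<open>For \<open>k = n\<close> the second sum is empty, so one formula covers every
    \<open>k \<ge> n\<close>.\<close>
  have "extended_sum D n k = (\<lambda>\<omega>. (\<Sum>i=1..n. D n i \<omega>) + (\<Sum>j=n+1..k. D j j \<omega>))"
    using assms by (auto simp: extended_sum_def row_sum_def)
  also have "\<dots> \<in> borel_measurable (F m k)"
    using assms by (intro borel_measurable_add borel_measurable_sum array_measurable) auto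
  finally show ?thesis .
qed

lemma integrable_extended_sum:
  assumes "1 \<le> n" "n \<le> k"
  shows "integrable P (extended_sum D n k)"
proof -
  have "extended_sum D n k = (\<lambda>\<omega>. (\<Sum>i=1..n. D n i \<omega>) + (\<Sum>j=n+1..k. D j j \<omega>))"
    using assms by (auto simp: extended_sum_def row_sum_def)
  moreover have "integrable P (\<lambda>\<omega>. (\<Sum>i=1..n. D n i \<omega>) + (\<Sum>j=n+1..k. D j j \<omega>))"
    using assms
    by (intro Bochner_Integration.integrable_add Bochner_Integration.integrable_sum array_integrable) auto
  ultimately show ?thesis by simp
qed

text \<open>From time \<open>k\<close> to \<open>Suc k\<close> the increment is the diagonal entry
  of row \<open>Suc k\<close>, which has zero conditional expectation given
  \<open>F (Suc k) k\<close>. The claim is then the one-step inequality for p-th powers.\<close>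

lemma extended_sum_submartingale:
  assumes "1 \<le> n" "n \<le> k" "1 \<le> p" "A \<in> sets (F k k)"
  shows "(\<integral>\<^sup>+\<omega>. ennreal (\<bar>extended_sum D n k \<omega>\<bar> powr p) * indicator A \<omega> \<partial>P)
    \<le> (\<integral>\<^sup>+\<omega>. ennreal (\<bar>extended_sum D n (Suc k) \<omega>\<bar> powr p) * indicator A \<omega> \<partial>P)"
proof -
  interpret prob_space P by (rule prob)
  have "extended_sum D n (Suc k) \<omega> = extended_sum D n k \<omega> + D (Suc k) (Suc k) \<omega>" for \<omega>
    using assms by (cases "k = n") (auto simp: extended_sum_def row_sum_def)
  \<comment> \<open>The event comes from row \<open>k\<close>, the martingale-difference property
    from row \<open>Suc k\<close>; the common filtration reconciles them, as
    \<open>k \<ge> 1\<close>.\<close>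
  moreover have "A \<in> sets (F (Suc k) k)"
    using assms F_G[of k k] F_G[of k "Suc k"] by simp
  moreover have "AE \<omega> in P. real_cond_exp P (F (Suc k) k) (D (Suc k) (Suc k)) \<omega> = 0"
    using mda unfolding martingale_difference_array_def
    by (metis One_nat_def diff_Suc_1 le_add1 order_refl plus_1_eq_Suc)
  ultimately show ?thesis
    using assms
    by (auto intro!: nn_integral_abs_powr_martingale_step[where H = "F (Suc k) k"] array_subalgebra
        extended_sum_measurable integrable_extended_sum array_integrable)
qed

text \<open>The infinite-horizon inequality applied to p-th powers, with time restarted at
  \<open>n\<close>: the level becomes \<open>\<epsilon> powr p\<close> and the weights
  \<open>c (n + j) powr p\<close>. The process is a martingale only from \<open>k = n\<close> on in
  the sense used here, which is why earlier times are left out.\<close>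

lemma extended_sum_maximal_inequality:
  assumes "1 \<le> n" "1 \<le> p" "0 < \<epsilon>"
    and c: "\<And>n. 1 \<le> n \<Longrightarrow> 0 < c n" "\<And>m n. 1 \<le> m \<Longrightarrow> m \<le> n \<Longrightarrow> c n \<le> c m"
    and lim: "(\<lambda>k. ennreal (c k powr p) * abs_moment P p (extended_sum D n k)) \<longlonglongrightarrow> 0"
  shows "ennreal (\<epsilon> powr p) * emeasure P {\<omega> \<in> space P. \<exists>j. \<epsilon> \<le> c (n + j) * \<bar>extended_sum D n (n + j) \<omega>\<bar>}
    \<le> (\<Sum>j. ennreal (c (n + j) powr p - c (n + j + 1) powr p) * abs_moment P p (extended_sum D n (n + j)))"
proof -
  define X where "X j \<omega> = ennreal (\<bar>extended_sum D n (n + j) \<omega>\<bar> powr p)" for j \<omega>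
  define u where "u j = ennreal (c (n + j) powr p)" for j
  have moment: "(\<integral>\<^sup>+\<omega>. X j \<omega> \<partial>P) = abs_moment P p (extended_sum D n (n + j))" for j
    by (simp add: X_def abs_moment_def)
  have "ennreal (\<epsilon> powr p) * emeasure P {\<omega> \<in> space P. \<exists>j. ennreal (\<epsilon> powr p) \<le> u j * X j \<omega>}
    \<le> (\<Sum>j. (u j - u (Suc j)) * (\<integral>\<^sup>+\<omega>. X j \<omega> \<partial>P))"
  proof (rule submartingale_maximal_inequality_infinite)
    show "subalgebra P (F (n + k) (n + k))" for k
      using assms by (intro array_subalgebra) auto
    show "sets (F (n + k) (n + k)) \<subseteq> sets (F (n + Suc k) (n + Suc k))" for k
      using assms F_G[of "n + k" "n + k"] F_G[of "n + Suc k" "n + Suc k"]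
        array_sets_mono[of "n + k" "n + Suc k"] by simp
    show "X k \<in> borel_measurable (F (n + k) (n + k))" for k
    proof -
      have [measurable]: "extended_sum D n (n + k) \<in> borel_measurable (F (n + k) (n + k))"
        using assms by (intro extended_sum_measurable) auto
      show ?thesis unfolding X_def by measurable
    qed
    show "(\<integral>\<^sup>+\<omega>. X k \<omega> * indicator A \<omega> \<partial>P) \<le> (\<integral>\<^sup>+\<omega>. X (Suc k) \<omega> * indicator A \<omega> \<partial>P)"
      if "A \<in> sets (F (n + k) (n + k))" for k A
      unfolding X_def using extended_sum_submartingale[of n "n + k" p A] that assms by simp
    show "u (Suc k) \<le> u k" for k
      unfolding u_def using assms less_imp_le[OF c(1)[of "n + Suc k"]] c(2)[of "n + k" "n + Suc k"]
      by (intro ennreal_leI powr_mono2) auto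
    show "(\<lambda>N. u N * (\<integral>\<^sup>+\<omega>. X N \<omega> \<partial>P)) \<longlonglongrightarrow> 0"
      unfolding u_def moment using LIMSEQ_ignore_initial_segment[OF lim, of n] by (simp add: add.commute)
  qed (auto simp: u_def)
  \<comment> \<open>The p-th power is strictly increasing on nonnegative reals, so the two level
    events coincide.\<close>
  moreover have "ennreal (\<epsilon> powr p) \<le> u j * X j \<omega> \<longleftrightarrow> \<epsilon> \<le> c (n + j) * \<bar>extended_sum D n (n + j) \<omega>\<bar>" for j \<omega>
  proof -
    have "0 \<le> c (n + j)"
      using less_imp_le[OF c(1)[of "n + j"]] \<open>1 \<le> n\<close> by simp
    then have "u j * X j \<omega> = ennreal ((c (n + j) * \<bar>extended_sum D n (n + j) \<omega>\<bar>) powr p)"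
      by (simp add: u_def X_def powr_mult ennreal_mult')
    moreover have "\<epsilon> powr p \<le> y powr p \<longleftrightarrow> \<epsilon> \<le> y" if "0 \<le> y" for y
      using powr_less_mono2[of p y \<epsilon>] powr_mono2[of p \<epsilon> y] that \<open>1 \<le> p\<close> \<open>0 < \<epsilon>\<close>
      by (cases "\<epsilon> \<le> y") auto
    ultimately show ?thesis
      using \<open>0 \<le> c (n + j)\<close> by simp
  qed
  moreover have "u j - u (Suc j) = ennreal (c (n + j) powr p - c (n + j + 1) powr p)" for j
    by (simp add: u_def ennreal_minus)
  ultimately show ?thesis
    by (simp add: moment)
qed

end

section \<open>Almost sure convergence\<close>

lemma tendsto_0_add_ennrealD:
  fixes f g :: "nat \<Rightarrow> ennreal"
  assumes "(\<lambda>n. f n + g n) \<longlonglongrightarrow> 0"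
  shows "f \<longlonglongrightarrow> 0" "g \<longlonglongrightarrow> 0"
  by (rule tendsto_sandwich[OF _ _ tendsto_const assms]; simp)+

theorem corollary1p1:
  fixes P :: "'a measure"
    and F :: "nat \<Rightarrow> nat \<Rightarrow> 'a measure"
    and G :: "nat \<Rightarrow> 'a measure"
    and D :: "nat \<Rightarrow> nat \<Rightarrow> 'a \<Rightarrow> real"
    and c :: "nat \<Rightarrow> real"
  assumes "prob_space P"
    and "martingale_difference_array P F D"
    and "\<And>n. 1 \<le> n \<Longrightarrow> 0 < c n"
    and "\<And>m n. 1 \<le> m \<Longrightarrow> m \<le> n \<Longrightarrow> c n \<le> c m"
    and "\<And>n i. 1 \<le> i \<Longrightarrow> i \<le> n \<Longrightarrow> sets (F n i) = sets (G i)"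
    and "\<exists>p::real. 1 \<le> p \<and>
      (\<forall>n0\<ge>1.
        (\<lambda>n. ennreal (c n powr p) * abs_moment P p (extended_sum D n0 n)
             + (\<Sum>j. ennreal (c (n + j) powr p - c (n + j + 1) powr p)
                     * abs_moment P p (extended_sum D n (n + j))))
          \<longlonglongrightarrow> 0) \<and>
      (\<Sum>n. ennreal (c (n + 1)) * Lp_norm P p (row_change D (n + 1))) < \<infinity>"
  shows "AE \<omega> in P. (\<lambda>n. c n * row_sum D n n \<omega>) \<longlonglongrightarrow> 0"
proof -
  interpret prob_space P by fact
  note array = assms(1,2,5)
  from assms(6) obtain p :: real where p: "1 \<le> p"
    and lim: "\<And>n0. 1 \<le> n0 \<Longrightarrow> (\<lambda>n. ennreal (c n powr p) * abs_moment P p (extended_sum D n0 n)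
             + (\<Sum>j. ennreal (c (n + j) powr p - c (n + j + 1) powr p)
                     * abs_moment P p (extended_sum D n (n + j)))) \<longlonglongrightarrow> 0"
    and R: "(\<Sum>n. ennreal (c (n + 1)) * Lp_norm P p (row_change D (n + 1))) < \<infinity>"
    by blast
  define A where "A \<epsilon> n = {\<omega> \<in> space P. \<exists>j. \<epsilon> \<le> c (n + j) * \<bar>extended_sum D n (n + j) \<omega>\<bar>}" for \<epsilon> n
  have A_meas: "A \<epsilon> n \<in> sets P" if "1 \<le> n" for \<epsilon> n
  proof -
    have [measurable]: "extended_sum D n (n + j) \<in> borel_measurable P" for j
      using integrable_extended_sum[OF array, of n "n + j"] that by auto
    show ?thesis unfolding A_def by measurable
  qed
  have null: "AE \<omega> in P. \<exists>n\<ge>Suc m. \<omega> \<notin> A \<epsilon> n" if "0 < \<epsilon>" for \<epsilon> m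
  proof -
    \<comment> \<open>\<open>B\<close> lies in \<open>A \<epsilon> n\<close> for every
      \<open>n > m\<close>, so its probability is bounded along a sequence tending to zero.\<close>
    define B where "B = (\<Inter>n\<in>{Suc m..}. A \<epsilon> n)"
    have B: "B \<in> sets P"
      unfolding B_def using A_meas by (intro sets.countable_INT') auto
    have le: "ennreal (\<epsilon> powr p) * emeasure P B \<le>
      (\<Sum>j. ennreal (c (n + j) powr p - c (n + j + 1) powr p) * abs_moment P p (extended_sum D n (n + j)))"
      if "Suc m \<le> n" for n
    proof -
      have "emeasure P B \<le> emeasure P (A \<epsilon> n)"
        using that by (intro emeasure_mono A_meas) (auto simp: B_def)
      then have "ennreal (\<epsilon> powr p) * emeasure P B \<le> ennreal (\<epsilon> powr p) * emeasure P (A \<epsilon> n)"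
        by (intro mult_left_mono) auto
      also have "\<dots> \<le> (\<Sum>j. ennreal (c (n + j) powr p - c (n + j + 1) powr p)
          * abs_moment P p (extended_sum D n (n + j)))"
        unfolding A_def
        \<comment> \<open>Taking \<open>n0 = n\<close> in the limit hypothesis makes the boundary
          term of the maximal inequality vanish.\<close>
        using that p \<open>0 < \<epsilon>\<close> assms(3,4) tendsto_0_add_ennrealD(1)[OF lim[of n]]
        by (intro extended_sum_maximal_inequality[OF array]) auto
      finally show ?thesis .
    qed
    have "ennreal (\<epsilon> powr p) * emeasure P B \<le> 0"
      \<comment> \<open>The series does not involve \<open>n0\<close>, so the choice
        \<open>n0 = 1\<close> already shows that it tends to zero.\<close>
      using le by (intro LIMSEQ_le_const[OF tendsto_0_add_ennrealD(2)[OF lim[of 1]]]) auto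
    then have "emeasure P B = 0"
      using \<open>0 < \<epsilon>\<close> by (auto simp: ennreal_eq_0_iff)
    then show ?thesis
      using B by (intro AE_I[of _ _ B]) (auto simp: B_def)
  qed
  \<comment> \<open>A single countable index \<open>m\<close> serves both as the lower bound on
    \<open>n\<close> and, through its reciprocal, as the level.\<close>
  have "AE \<omega> in P. \<forall>m. \<exists>n\<ge>Suc m. \<omega> \<notin> A (inverse (real (Suc m))) n"
    unfolding AE_all_countable using null by simp
  moreover have "AE \<omega> in P. summable (\<lambda>j. c (j + 1) * \<bar>row_change D (j + 1) \<omega>\<bar>)"
  proof -
    have [measurable]: "row_change D (Suc j) \<in> borel_measurable P" for j
      using integrable_row_change[OF array, of j] by auto
    have "(\<integral>\<^sup>+\<omega>. (\<Sum>j. ennreal (c (j + 1) * \<bar>row_change D (j + 1) \<omega>\<bar>)) \<partial>P)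
        = (\<Sum>j. \<integral>\<^sup>+\<omega>. ennreal (c (j + 1) * \<bar>row_change D (j + 1) \<omega>\<bar>) \<partial>P)"
      by (intro nn_integral_suminf) simp
    also have "\<dots> = (\<Sum>j. ennreal (c (j + 1)) * (\<integral>\<^sup>+\<omega>. ennreal \<bar>row_change D (j + 1) \<omega>\<bar> \<partial>P))"
      using assms(3) by (intro suminf_cong)
        (simp add: ennreal_mult' less_imp_le nn_integral_cmult)
    also have "\<dots> \<le> (\<Sum>j. ennreal (c (j + 1)) * Lp_norm P p (row_change D (j + 1)))"
      using nn_integral_abs_le_Lp_norm[OF p integrable_row_change[OF array]]
      by (intro suminf_le mult_left_mono) auto
    also note R
    finally have "(\<integral>\<^sup>+\<omega>. (\<Sum>j. ennreal (c (j + 1) * \<bar>row_change D (j + 1) \<omega>\<bar>)) \<partial>P) \<noteq> \<infinity>"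
      by simp
    then have "AE \<omega> in P. (\<Sum>j. ennreal (c (j + 1) * \<bar>row_change D (j + 1) \<omega>\<bar>)) \<noteq> \<infinity>"
      by (intro nn_integral_noteq_infinite) simp_all
    then show ?thesis
    proof eventually_elim
      case (elim \<omega>)
      then show ?case
        using less_imp_le[OF assms(3)]
        by (intro summable_suminf_not_top) (auto intro!: mult_nonneg_nonneg)
    qed
  qed
  ultimately show ?thesis
    using AE_space
  proof eventually_elim
    case (elim \<omega>)
    define T where "T n = (\<Sum>j. c (j + n + 1) * \<bar>row_change D (j + n + 1) \<omega>\<bar>)" for n
    show ?case
    proof (rule LIMSEQ_I)
      fix r :: real
      assume "0 < r"
      then obtain m1 where m1: "\<And>n. m1 \<le> n \<Longrightarrow> norm (T n) < r / 2"
        using suminf_exist_split[OF _ elim(2), of "r / 2"] by (auto simp: T_def)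
      from \<open>0 < r\<close> obtain m2 where m2: "inverse (real (Suc m2)) < r / 2"
        using reals_Archimedean[of "r / 2"] by auto
      \<comment> \<open>With this \<open>m\<close>, every \<open>n > m\<close> has tail
        \<open>T n\<close> below \<open>r / 2\<close>, and the level
        \<open>inverse (real (Suc m))\<close> is also below \<open>r / 2\<close>.\<close>
      define m where "m = max m1 m2"
      have m: "inverse (real (Suc m)) \<le> inverse (real (Suc m2))"
        by (simp add: m_def field_simps)
      \<comment> \<open>One such \<open>n\<close> is enough: avoiding \<open>A\<close> bounds the
        martingale part for all \<open>k \<ge> n\<close>, and \<open>T n\<close> bounds the
        remainder for the same \<open>k\<close>.\<close>
      obtain n where n: "Suc m \<le> n" "\<omega> \<notin> A (inverse (real (Suc m))) n"
        using elim(1) by blast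
      have "norm (c k * row_sum D k k \<omega> - 0) < r" if "n \<le> k" for k
      proof -
        have "0 < c k"
          using assms(3)[of k] n that by simp
        have "row_sum D k k \<omega> = extended_sum D n k \<omega> + (\<Sum>j=n+1..k. row_change D j \<omega>)"
          using n that by (intro row_sum_diagonal_decomposition) auto
        then have "\<bar>c k * row_sum D k k \<omega>\<bar>
            \<le> c k * \<bar>extended_sum D n k \<omega>\<bar> + c k * \<bar>\<Sum>j=n+1..k. row_change D j \<omega>\<bar>"
          using \<open>0 < c k\<close> by (simp add: abs_mult distrib_left[symmetric])
        moreover have "c k * \<bar>extended_sum D n k \<omega>\<bar> < inverse (real (Suc m))"
          using n(2) elim(3) le_Suc_ex[OF that] by (force simp: A_def not_le)
        moreover have "c k * \<bar>\<Sum>j=n+1..k. row_change D j \<omega>\<bar> \<le> T n"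
          unfolding T_def using assms(3,4) elim(2) by (intro weighted_sum_bound) auto
        moreover have "T n < r / 2"
          using abs_ge_self[of "T n"] m1[of n] n(1) unfolding m_def real_norm_def by linarith
        ultimately show ?thesis
          using m m2 by (simp only: diff_zero real_norm_def)
      qed
      then show "\<exists>no. \<forall>k\<ge>no. norm (c k * row_sum D k k \<omega> - 0) < r"
        by blast
    qed
  qed
qed

end
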